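(* Fix $q\in(0,1)$ and put $s=1-q$. There exist constants $c_A,C_A,\delta_A>0$ depending only on $q$ such that the following holds. Let $T_0$ be any positive-integer-valued, almost surely finite random variable with probability generating function $g$, let $T$ be the completion time under memoryless catastrophe with rate $q$, and put $p=g(s)$, $\alpha=\dfrac{s(p-q\,g'(s))}{1-p}$. If $p+|\alpha|\le\delta_A$, then \[ c_A\,(p+|\alpha|)\;\le\; d_{\mathrm K}\!\left(\frac{T}{E[T]},\,\mathrm{Exp}(1)\right)\;\le\; C_A\,(p+|\alpha|). \]
   Context: $g(z)=E[z^{T_0}]$. $\mathrm{Exp}(1)$ is the exponential distribution with mean $1$, and $d_{\mathrm K}(X,Y)=\sup_{x\in\mathbb R}|P(X\le x)-P(Y\le x)|$ is the Kolmogorov distance. Memoryless catastrophe with rate $q$: at each step, independently of everything else, a catastrophe occurs with probability $q$; if it occurs before the base task has completed, all progress is destroyed and the process restarts from scratch with a fresh independent copy of $T_0$; the process terminates at the first step at which no catastrophe occurs and the base task completes. Formally, attempts $i=1,2,\dots$ are independent; attempt $i$ has a copy $T_0^{(i)}$ of $T_0$ and an independent $\tau_i$ with $P(\tau_i>t)=s^t$, $t=0,1,2,\dots$; it succeeds iff $T_0^{(i)}<\tau_i$, and lasts $\min(T_0^{(i)},\tau_i)$ steps. $T$ is the total length of all attempts up to and including the first successful one. The success probability of an attempt is $p=g(s)$, and $E[T]=(1-p)/(qp)$. *)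

theory Defs
  imports "HOL-Probability.Probability"
begin

text \<open>
  The law of a positive-integer-valued, almost surely finite random variable is a
  \<^typ>\<open>nat pmf\<close> that gives no mass to \<open>0\<close>.
\<close>

definition pgf :: "nat pmf \<Rightarrow> real \<Rightarrow> real" where
  "pgf D z = measure_pmf.expectation D (\<lambda>n. z ^ n)"

text \<open>
  The library's \<^const>\<open>geometric_pmf\<close> lives on \<open>{0, 1, 2, \<dots>}\<close>, while the first catastrophe
  happens at step 1 at the earliest; see \<open>catastrophe_pmf_tail\<close> below.
\<close>

definition catastrophe_pmf :: "real \<Rightarrow> nat pmf" where
  "catastrophe_pmf q = map_pmf Suc (geometric_pmf q)"

text \<open>
  The canonical probability space of i.i.d. attempts: coordinate \<open>i\<close> (counted from \<open>0\<close>) is the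
  pair of the copy of the base time and the independent catastrophe time of that attempt.
\<close>

definition attempts :: "real \<Rightarrow> nat pmf \<Rightarrow> (nat \<Rightarrow> nat \<times> nat) measure" where
  "attempts q D = PiM UNIV (\<lambda>_::nat. measure_pmf (pair_pmf D (catastrophe_pmf q)))"

definition first_success :: "(nat \<Rightarrow> nat \<times> nat) \<Rightarrow> nat" where
  "first_success \<omega> = (LEAST i. fst (\<omega> i) < snd (\<omega> i))"

text \<open>
  If no attempt succeeds, which has probability \<open>0\<close>, the value is an unspecified number.
\<close>

definition completion_time :: "(nat \<Rightarrow> nat \<times> nat) \<Rightarrow> nat" where
  "completion_time \<omega> = (\<Sum>i\<le>first_success \<omega>. min (fst (\<omega> i)) (snd (\<omega> i)))"

definition expected_completion_time :: "real \<Rightarrow> nat pmf \<Rightarrow> real" where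
  "expected_completion_time q D = (\<integral>\<omega>. real (completion_time \<omega>) \<partial>attempts q D)"

definition normalized_completion_law :: "real \<Rightarrow> nat pmf \<Rightarrow> real measure" where
  "normalized_completion_law q D =
     distr (attempts q D) borel
       (\<lambda>\<omega>. real (completion_time \<omega>) / expected_completion_time q D)"

definition exp1_law :: "real measure" where
  "exp1_law = density lborel (exponential_density 1)"

definition kolmogorov_dist :: "real measure \<Rightarrow> real measure \<Rightarrow> real" where
  "kolmogorov_dist M N = (SUP x. \<bar>cdf M x - cdf N x\<bar>)"


lemma catastrophe_pmf_tail:
  assumes q: "0 < q" "q < 1"
  shows "measure_pmf.prob (catastrophe_pmf q) {t<..} = (1 - q) ^ t"
proof (induction t)
  case 0
  have "measure_pmf.prob (catastrophe_pmf q) {0<..} = measure_pmf.prob (geometric_pmf q) UNIV"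
    unfolding catastrophe_pmf_def measure_map_pmf by (rule arg_cong) auto
  then show ?case by simp
next
  case (Suc t)
  have pm: "measure_pmf.prob (catastrophe_pmf q) {Suc t} = (1 - q) ^ t * q"
  proof -
    have "measure_pmf.prob (catastrophe_pmf q) {Suc t} = pmf (geometric_pmf q) t"
      unfolding catastrophe_pmf_def measure_map_pmf
      by (simp add: measure_pmf_single[symmetric] vimage_def)
    then show ?thesis using q by simp
  qed
  have "{t<..} = {Suc t} \<union> {Suc t<..}" by auto
  then have "measure_pmf.prob (catastrophe_pmf q) {t<..} =
      measure_pmf.prob (catastrophe_pmf q) {Suc t}
      + measure_pmf.prob (catastrophe_pmf q) {Suc t<..}"
    by (simp only:, subst measure_pmf.finite_measure_Union) auto
  with Suc pm show ?case by (simp add: algebra_simps)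
qed

lemma sets_attempts:
  "sets (attempts q D) = sets (PiM UNIV (\<lambda>_::nat. count_space (UNIV :: (nat \<times> nat) set)))"
  unfolding attempts_def by (intro sets_PiM_cong) auto

lemma measurable_completion_time:
  "completion_time \<in>
     measurable (PiM UNIV (\<lambda>_::nat. count_space (UNIV :: (nat \<times> nat) set))) (count_space UNIV)"
proof -
  let ?P = "PiM UNIV (\<lambda>_::nat. count_space (UNIV :: (nat \<times> nat) set))"
  have c[measurable]: "(\<lambda>\<omega>. f (\<omega> i)) \<in> measurable ?P (count_space UNIV)"
    for i and f :: "nat \<times> nat \<Rightarrow> 'c"
    by (rule measurable_compose[OF measurable_component_singleton[of i]]) auto
  have suc: "Measurable.pred ?P (\<lambda>\<omega>. fst (\<omega> i) < snd (\<omega> i))" for i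
    using c[of "\<lambda>x. fst x < snd x" i] by simp
  have [measurable]: "first_success \<in> measurable ?P (count_space UNIV)"
    unfolding first_success_def by (rule measurable_Least) (rule suc)
  have [measurable]: "(\<lambda>\<omega>. \<Sum>i\<le>n. min (fst (\<omega> i)) (snd (\<omega> i))) \<in> measurable ?P (count_space UNIV)"
    for n :: nat
  proof (induction n)
    case 0
    show ?case using c[of "\<lambda>x. min (fst x) (snd x)" 0] by simp
  next
    case (Suc n)
    note Suc[measurable] and c[of "\<lambda>x. min (fst x) (snd x)" "Suc n", measurable]
    show ?case unfolding sum.atMost_Suc by measurable
  qed
  show ?thesis
    unfolding completion_time_def
    by (rule measurable_compose_countable[where f="\<lambda>n \<omega>. \<Sum>i\<le>n. min (fst (\<omega> i)) (snd (\<omega> i))"])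
      measurable
qed

lemma nat_law_eq_of_tail:
  fixes P :: "nat pmf"
  assumes M: "prob_space M" and X: "X \<in> measurable M (count_space UNIV)"
    and tail: "\<And>t. measure M {\<omega> \<in> space M. t < X \<omega>} = measure_pmf.prob P {t<..}"
    and pos: "measure_pmf.prob P {0<..} = 1"
  shows "distr M (count_space UNIV) X = measure_pmf P"
proof -
  interpret prob_space M by fact
  interpret D: prob_space "distr M (count_space UNIV) X" by (rule prob_space_distr) fact
  let ?D = "distr M (count_space UNIV) X"
  have t: "measure ?D {t<..} = measure_pmf.prob P {t<..}" for t
    using tail[of t] X by (simp add: measure_distr vimage_def Int_def conj_commute)
  have "measure ?D {n} = measure_pmf.prob P {n}" for n
  proof (cases n)
    case 0
    have "{0::nat} = UNIV - {0<..}" by auto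
    then show ?thesis
      using D.prob_compl[of "{0<..}"] measure_pmf.prob_compl[of "{0<..}" P] t[of 0] 0 by simp
  next
    case (Suc m)
    have "{n} = {m<..} - {n<..}" using Suc by auto
    then show ?thesis
      using D.finite_measure_Diff[of "{m<..}" "{n<..}"]
        measure_pmf.finite_measure_Diff[of "{m<..}" P "{n<..}"] t[of m] t[of n] Suc
      by auto
  qed
  then show ?thesis
    by (intro measure_eqI_countable[of _ UNIV])
      (auto simp: D.emeasure_eq_measure measure_pmf.emeasure_eq_measure)
qed

text \<open>
  Any realization of the process, on any probability space, has the law of the canonical one.
\<close>

lemma distr_completion_time:
  fixes M :: "'w measure" and X tau :: "nat \<Rightarrow> 'w \<Rightarrow> nat"
  assumes M: "prob_space M" and q: "0 < q" "q < 1"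
    and indep: "prob_space.indep_vars M (\<lambda>_. count_space UNIV) (\<lambda>i \<omega>. (X i \<omega>, tau i \<omega>)) UNIV"
    and indep2: "\<And>i. prob_space.indep_var M (count_space UNIV) (X i) (count_space UNIV) (tau i)"
    and lawX: "\<And>i. distr M (count_space UNIV) (X i) = measure_pmf D"
    and tail: "\<And>i t. measure M {\<omega> \<in> space M. t < tau i \<omega>} = (1 - q) ^ t"
  shows "distr M (count_space UNIV) (\<lambda>\<omega>. completion_time (\<lambda>i. (X i \<omega>, tau i \<omega>))) =
         distr (attempts q D) (count_space UNIV) completion_time"
proof -
  interpret prob_space M by fact
  let ?C = "\<lambda>_::nat. count_space (UNIV :: (nat \<times> nat) set)"
  have rv: "(\<lambda>\<omega>. (X i \<omega>, tau i \<omega>)) \<in> measurable M (count_space UNIV)" for i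
    using indep unfolding indep_vars_def by auto
  have rvX: "X i \<in> measurable M (count_space UNIV)"
    and rvt: "tau i \<in> measurable M (count_space UNIV)" for i
    using indep2[of i] by (auto dest: indep_var_rv1 indep_var_rv2)
  have lawt: "distr M (count_space UNIV) (tau i) = measure_pmf (catastrophe_pmf q)" for i
    by (rule nat_law_eq_of_tail[OF M rvt]) (simp_all add: tail catastrophe_pmf_tail[OF q])
  have pair: "distr M (count_space UNIV) (\<lambda>\<omega>. (X i \<omega>, tau i \<omega>)) =
      measure_pmf (pair_pmf D (catastrophe_pmf q))" for i
  proof -
    have sing: "measure M {\<omega> \<in> space M. X i \<omega> = a \<and> tau i \<omega> = b} =
        pmf D a * pmf (catastrophe_pmf q) b" for a b
    proof -
      have "prob ((\<lambda>\<omega>. (X i \<omega>, tau i \<omega>)) -` ({a} \<times> {b}) \<inter> space M) =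
          prob (X i -` {a} \<inter> space M) * prob (tau i -` {b} \<inter> space M)"
        by (rule indep_varD[OF indep2]) auto
      also have "prob (X i -` {a} \<inter> space M) = measure (distr M (count_space UNIV) (X i)) {a}"
        using rvX by (simp add: measure_distr)
      also have "prob (tau i -` {b} \<inter> space M) = measure (distr M (count_space UNIV) (tau i)) {b}"
        using rvt by (simp add: measure_distr)
      also have "(\<lambda>\<omega>. (X i \<omega>, tau i \<omega>)) -` ({a} \<times> {b}) \<inter> space M =
          {\<omega> \<in> space M. X i \<omega> = a \<and> tau i \<omega> = b}" by auto
      finally show ?thesis by (simp add: lawX lawt measure_pmf_single)
    qed
    interpret E: prob_space "distr M (count_space UNIV) (\<lambda>\<omega>. (X i \<omega>, tau i \<omega>))"
      by (rule prob_space_distr) (rule rv)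
    show ?thesis
    proof (rule measure_eqI_countable[of _ UNIV])
      fix x :: "nat \<times> nat"
      obtain a b where x: "x = (a, b)" by (cases x)
      have "measure (distr M (count_space UNIV) (\<lambda>\<omega>. (X i \<omega>, tau i \<omega>))) {x} =
          measure M {\<omega> \<in> space M. X i \<omega> = a \<and> tau i \<omega> = b}"
        using rv[of i] x
        by (subst measure_distr) (auto intro!: arg_cong[where f="measure M"])
      also have "\<dots> = measure_pmf.prob (pair_pmf D (catastrophe_pmf q)) {x}"
        by (simp add: sing x measure_pmf_single pmf_pair)
      finally show "emeasure (distr M (count_space UNIV) (\<lambda>\<omega>. (X i \<omega>, tau i \<omega>))) {x} =
          emeasure (measure_pmf (pair_pmf D (catastrophe_pmf q))) {x}"
        by (simp add: E.emeasure_eq_measure measure_pmf.emeasure_eq_measure)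
    qed auto
  qed
  have joint: "distr M (PiM UNIV ?C) (\<lambda>\<omega>. \<lambda>i\<in>UNIV. (X i \<omega>, tau i \<omega>)) = attempts q D"
    using indep_vars_iff_distr_eq_PiM[where I=UNIV and M'="?C" and X="\<lambda>i \<omega>. (X i \<omega>, tau i \<omega>)"] rv indep
    by (simp add: pair attempts_def)
  have meas: "(\<lambda>\<omega>. \<lambda>i\<in>UNIV. (X i \<omega>, tau i \<omega>)) \<in> measurable M (PiM UNIV ?C)"
    by (rule measurable_restrict) (rule rv)
  show ?thesis
    unfolding joint[symmetric]
    by (subst distr_distr[OF measurable_completion_time meas]) (simp add: comp_def restrict_def)
qed

end

theory Submission
  imports Defs
begin

text \<open>
  Put \<open>a t = P(T > t)\<close>, \<open>w k = P(T\<^sub>0 = k) s\<^sup>k\<close>, \<open>m = \<Sum>k. k w k = s g'(s)\<close> and \<open>x = q p / (1 - p) = 1 / E[T]\<close>.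
  Conditioning on the first attempt gives \<open>a t - a (t + 1) = w (t + 1) + q \<Sum>i\<le>t. w i a (t - i)\<close>.
  Since \<open>(1 - p) \<alpha> = s p - q m\<close>, the quantity \<open>p + |\<alpha>|\<close> is comparable to \<open>p + q m\<close> when \<open>p \<le> 1 / 2\<close>.

  Upper bound: the right-hand side of the recursion differs from \<open>q p a t\<close> by terms whose absolute
  sum is at most \<open>p + 2 q m\<close>, so \<open>a t\<close> is that close to \<open>(1 - q p)\<^sup>t\<close>, hence to \<open>exp (- t x)\<close>.

  Lower bound: \<open>T \<ge> 1\<close> forces the distance to be at least \<open>1 - exp (- x / 2)\<close>, which is of order \<open>p\<close>.
  Summing \<open>|a t - z\<^sup>t| \<le> d\<close> against \<open>z\<^sup>t\<close> with \<open>z = exp (- x)\<close> and inserting the closed form of the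
  generating function of \<open>a\<close> bounds \<open>(p - g(s z)) / p\<close>, which is of order \<open>q m\<close>, by a multiple of
  \<open>d + p\<close>.
\<close>

subsection \<open>Defective renewal sequences\<close>

text \<open>The error \<open>x n - r ^ n\<close> starts at 0 and is multiplied by \<open>r\<close>
  before each new \<open>v n\<close> is subtracted. As \<open>0 \<le> r \<le> 1\<close>, old errors
  are never amplified and merely add up.\<close>

lemma perturbed_geometric:
  fixes x v :: "nat \<Rightarrow> real"
  assumes "x 0 = 1" and rec: "\<And>t. x (Suc t) = r * x t - v t" and r: "0 \<le> r" "r \<le> 1"
  shows "\<bar>x n - r ^ n\<bar> \<le> (\<Sum>t<n. \<bar>v t\<bar>)"
proof (induction n)
  case (Suc n)
  have "\<bar>x (Suc n) - r ^ Suc n\<bar> = \<bar>r * (x n - r ^ n) - v n\<bar>" by (simp add: rec algebra_simps)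
  also have "\<dots> \<le> r * \<bar>x n - r ^ n\<bar> + \<bar>v n\<bar>"
    using abs_triangle_ineq4[of "r * (x n - r ^ n)" "v n"] r by (simp add: abs_mult)
  also have "\<dots> \<le> \<bar>x n - r ^ n\<bar> + \<bar>v n\<bar>"
    using mult_right_mono[OF r(2), of "\<bar>x n - r ^ n\<bar>"] by simp
  finally show ?case using Suc by simp
qed (simp add: assms)

lemma one_minus_exp_ge:
  fixes x :: real
  assumes "0 \<le> x" "x \<le> 1"
  shows "x / 2 \<le> 1 - exp (- x)"
proof -
  have "1 + x \<le> exp x" by (rule exp_ge_add_one_self)
  then have "exp (- x) \<le> 1 / (1 + x)" using assms by (simp add: exp_minus field_simps)
  also have "\<dots> \<le> 1 - x / 2" using assms mult_left_mono[of x 1 x]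
    by (simp add: field_simps)
  finally show ?thesis by simp
qed

lemma summable_times_power:
  fixes f :: "nat \<Rightarrow> real" and z :: real
  assumes "summable f" "\<And>k. 0 \<le> f k" "0 \<le> z" "z \<le> 1"
  shows "summable (\<lambda>k. f k * z ^ k)"
proof (rule summable_comparison_test'[OF assms(1)])
  show "norm (f k * z ^ k) \<le> f k" for k
    using assms mult_left_mono[OF power_le_one[of z k], of "f k"] by (simp add: abs_mult)
qed

text \<open>Isolates the facts about the process that the analytic estimates use, so that they can
  be proved for plain real sequences. Here \<open>w\<close> is the law of a successful base time,
  with total mass \<open>p\<close> rather than 1, and \<open>a\<close> is the tail of the completion
  time.\<close>

locale defective_renewal =
  fixes q p m :: real and w a :: "nat \<Rightarrow> real"
  assumes q_pos: "0 < q" and p_pos: "0 < p"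
    and w_nonneg: "0 \<le> w k" and w_0: "w 0 = 0" and w_sums: "w sums p"
    and mean_sums: "(\<lambda>k. real k * w k) sums m"
    and a_0: "a 0 = 1" and a_nonneg: "0 \<le> a t" and a_decseq: "decseq a"
    and a_rec: "a t - a (Suc t) = w (Suc t) + q * (\<Sum>i\<le>t. w i * a (t - i))"
begin

lemma a_le_1: "a t \<le> 1"
  using decseqD[OF a_decseq, of 0 t] by (simp add: a_0)

text \<open>Some \<open>w k\<close> is positive, and then every drop \<open>a t - a (Suc t)\<close>
  with \<open>t \<ge> k\<close> is at least \<open>q * w k * a (t - k)\<close>. The drops telescope
  to at most 1, which bounds the partial sums.\<close>

lemma summable_a: "summable a"
proof -
  obtain k where k: "0 < w k"
  proof (rule ccontr)
    assume "\<not> thesis"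
    then have "w k = 0" for k using w_nonneg[of k] that[of k] by fastforce
    then have "w = (\<lambda>_. 0)" by auto
    then show False using w_sums p_pos sums_unique2[of w p 0] by auto
  qed
  have bound: "(\<Sum>t<n. a t) \<le> 1 / (q * w k)" for n
  proof -
    have "q * w k * (\<Sum>t<n. a t) = (\<Sum>t\<in>{k..<n+k}. q * (w k * a (t - k)))"
      by (simp add: sum_distrib_left atLeast0LessThan mult.assoc
          sum.shift_bounds_nat_ivl[of _ 0 k n, simplified])
    also have "\<dots> \<le> (\<Sum>t\<in>{k..<n+k}. a t - a (Suc t))"
    proof (rule sum_mono)
      fix t assume t: "t \<in> {k..<n + k}"
      have "w k * a (t - k) \<le> (\<Sum>i\<le>t. w i * a (t - i))"
        using t by (intro member_le_sum) (auto intro: mult_nonneg_nonneg w_nonneg a_nonneg)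
      then have "q * (w k * a (t - k)) \<le> q * (\<Sum>i\<le>t. w i * a (t - i))"
        using q_pos by simp
      then show "q * (w k * a (t - k)) \<le> a t - a (Suc t)"
        using w_nonneg[of "Suc t"] by (simp add: a_rec)
    qed
    also have "\<dots> = a k - a (n + k)"
      using sum_Suc_diff'[of k "n + k" "\<lambda>t. - a t"] by simp
    also have "\<dots> \<le> 1" using a_le_1[of k] a_nonneg[of "n+k"] by simp
    finally show ?thesis using k q_pos by (simp add: field_simps)
  qed
  show ?thesis
    by (rule bounded_imp_summable[of _ "1 / (q * w k)"]) (use bound[of "Suc _"] a_nonneg in \<open>auto simp: lessThan_Suc_atMost\<close>)
qed

text \<open>Multiply the recursion by \<open>z ^ Suc t\<close> and sum over \<open>t\<close>; the
  convolution becomes a Cauchy product. The product form avoids a division and keeps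
  \<open>z = 1\<close> admissible.\<close>

lemma generating_function:
  assumes z: "0 \<le> z" "z \<le> 1"
  shows "(\<Sum>k. a k * z ^ k) * (1 - z + q * z * (\<Sum>k. w k * z ^ k)) = 1 - (\<Sum>k. w k * z ^ k)"
proof -
  define A where "A = (\<Sum>k. a k * z ^ k)"
  define W where "W = (\<Sum>k. w k * z ^ k)"
  have sa: "summable (\<lambda>k. a k * z ^ k)" using summable_times_power[OF summable_a a_nonneg] z by blast
  have sw: "summable (\<lambda>k. w k * z ^ k)"
    using summable_times_power[OF sums_summable[OF w_sums] w_nonneg] z by blast
  have A: "(\<lambda>k. a k * z ^ k) sums A" and W: "(\<lambda>k. w k * z ^ k) sums W"
    using sa sw by (simp_all add: A_def W_def summable_sums)
  have "(\<lambda>t. \<Sum>i\<le>t. (w i * z ^ i) * (a (t - i) * z ^ (t - i))) sums (W * A)"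
    unfolding A_def W_def using sa sw a_nonneg w_nonneg z
    by (intro Cauchy_product_sums) (simp_all add: abs_mult)
  moreover have "(\<Sum>i\<le>t. (w i * z ^ i) * (a (t - i) * z ^ (t - i))) = (\<Sum>i\<le>t. w i * a (t - i)) * z ^ t" for t
    unfolding sum_distrib_right
    by (rule sum.cong) (auto simp: power_add[symmetric])
  ultimately have C: "(\<lambda>t. (\<Sum>i\<le>t. w i * a (t - i)) * z ^ t) sums (W * A)" by simp
  have A1: "(\<lambda>t. a (Suc t) * z ^ Suc t) sums (A - 1)"
    using A by (subst sums_Suc_iff) (simp add: a_0)
  have W1: "(\<lambda>t. w (Suc t) * z ^ Suc t) sums W"
    using W by (subst sums_Suc_iff) (simp add: w_0)
  have "(\<lambda>t. z * (a t * z ^ t) - a (Suc t) * z ^ Suc t) sums (z * A - (A - 1))"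
    by (intro sums_diff sums_mult A A1)
  moreover have "(\<lambda>t. w (Suc t) * z ^ Suc t + q * z * ((\<Sum>i\<le>t. w i * a (t - i)) * z ^ t))
      sums (W + q * z * (W * A))"
    by (intro sums_add sums_mult W1 C)
  moreover have "z * (a t * z ^ t) - a (Suc t) * z ^ Suc t =
      w (Suc t) * z ^ Suc t + q * z * ((\<Sum>i\<le>t. w i * a (t - i)) * z ^ t)" for t
  proof -
    have "z * (a t * z ^ t) - a (Suc t) * z ^ Suc t = (a t - a (Suc t)) * z ^ Suc t"
      by (simp add: algebra_simps)
    then show ?thesis unfolding a_rec by (simp add: algebra_simps)
  qed
  ultimately have "z * A - (A - 1) = W + q * z * (W * A)"
    by (simp only: sums_unique2)
  then show ?thesis unfolding A_def[symmetric] W_def[symmetric] by (simp add: algebra_simps)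
qed

text \<open>The case \<open>z = 1\<close> of the generating function; this sum of tails will be the
  mean of the completion time.\<close>

lemma suminf_a: "(\<Sum>t. a t) = (1 - p) / (q * p)"
  using generating_function[of 1] sums_unique[OF w_sums] q_pos p_pos by (simp add: field_simps)

lemma convolution_sums: "(\<lambda>t. \<Sum>i\<le>t. w i * a (t - i)) sums (p * (\<Sum>t. a t))"
  using Cauchy_product_sums[of w a] summable_a w_sums a_nonneg w_nonneg
  by (simp add: sums_iff)

text \<open>Exchange the order of summation: \<open>w i\<close> occurs in the tail beyond
  \<open>t\<close> only for \<open>t < i\<close>, hence at most \<open>i\<close> times.\<close>

lemma sum_tail_le: "(\<Sum>t<n. p - (\<Sum>i\<le>t. w i)) \<le> m"
proof (rule sums_le)
  have "(\<lambda>i. if i \<le> t then 0 else w i) sums (p - (\<Sum>i\<le>t. w i))" for t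
    using sums_diff[OF w_sums sums_If_finite_set[of "{..t}" w]]
    by (rule sums_cong[THEN iffD1, rotated]) auto
  then show "(\<lambda>i. \<Sum>t<n. if i \<le> t then 0 else w i) sums (\<Sum>t<n. p - (\<Sum>i\<le>t. w i))"
    by (intro sums_sum)
  show "(\<Sum>t<n. if i \<le> t then 0 else w i) \<le> real i * w i" for i
  proof -
    have "(\<Sum>t<n. if i \<le> t then 0 else w i) = (\<Sum>t\<in>{..<n} \<inter> {..<i}. w i)"
      by (subst sum.inter_restrict) (auto intro: sum.cong)
    also have "\<dots> \<le> (\<Sum>t<i. w i)" by (rule sum_mono2) (auto intro: w_nonneg)
    finally show ?thesis by simp
  qed
qed (rule mean_sums)

lemma sum_w_le: "finite I \<Longrightarrow> sum w I \<le> p"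
  using sum_le_suminf[OF sums_summable[OF w_sums]] sums_unique[OF w_sums] w_nonneg by auto

text \<open>
  The deviations \<open>c t - p * a t\<close> of the convolution \<open>c\<close> of \<open>w\<close> and \<open>a\<close> sum to zero, so their total
  variation is twice the total of their negative parts, which come from the truncation of the
  convolution at \<open>t\<close> alone because \<open>a\<close> is decreasing.
\<close>

lemma sum_convolution_deviation_le:
  "(\<Sum>t<n. \<bar>(\<Sum>i\<le>t. w i * a (t - i)) - p * a t\<bar>) \<le> 2 * m"
proof -
  define x where "x t = (\<Sum>i\<le>t. w i * a (t - i)) - p * a t" for t
  define y where "y t = p - (\<Sum>i\<le>t. w i)" for t
  have y: "0 \<le> y t" for t using sum_w_le[of "{..t}"] by (simp add: y_def)
  have "x t \<ge> - y t * a t" for t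
  proof -
    have "(\<Sum>i\<le>t. w i * a t) \<le> (\<Sum>i\<le>t. w i * a (t - i))"
      by (intro sum_mono mult_left_mono w_nonneg decseqD[OF a_decseq]) auto
    then show ?thesis by (simp add: x_def y_def sum_distrib_right[symmetric] left_diff_distrib)
  qed
  moreover have "y t * a t \<le> y t" for t
    using mult_left_mono[OF a_le_1 y, of t t] by simp
  moreover have "0 \<le> y t * a t" for t by (intro mult_nonneg_nonneg y a_nonneg)
  ultimately have le: "\<bar>x t\<bar> \<le> x t + 2 * y t" for t
    by (smt (verit, best) minus_mult_left)
  \<comment> \<open>By the Cauchy product, the convolution has total \<open>p * suminf a\<close>,
    the same as \<open>p * a\<close>.\<close>
  have "x sums 0"
    using sums_diff[OF convolution_sums sums_mult[OF summable_sums[OF summable_a], of p]]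
    by (simp add: x_def[abs_def])
  moreover have sy: "summable y"
  proof (rule bounded_imp_summable[of _ m])
    show "sum y {..n} \<le> m" for n
      using sum_tail_le[of "Suc n"] by (simp add: y_def lessThan_Suc_atMost)
  qed (rule y)
  ultimately have xy: "(\<lambda>t. x t + 2 * y t) sums (0 + 2 * suminf y)"
    by (intro sums_add sums_mult summable_sums)
  have "(\<Sum>t<n. \<bar>x t\<bar>) \<le> (\<Sum>t<n. x t + 2 * y t)" by (intro sum_mono le)
  also have "\<dots> \<le> 2 * suminf y"
    using sum_le_suminf[OF sums_summable[OF xy], of "{..<n}"] sums_unique[OF xy] le
    by (smt (verit, best) finite_lessThan)
  also have "suminf y \<le> m"
    using suminf_le_const[OF sy] sum_tail_le by (simp add: y_def)
  finally show ?thesis by (simp add: x_def)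
qed

lemma m_nonneg: "0 \<le> m"
  using sum_tail_le[of 0] by simp

text \<open>Two comparisons with \<open>r ^ n\<close>, where \<open>r = 1 - q * p\<close>: the
  distance from \<open>a n\<close> is at most \<open>p + 2 * q * m\<close>, and the distance from
  the exponential is at most \<open>2 * p\<close>, uniformly in \<open>n\<close>.\<close>

lemma a_near_exp:
  assumes q: "q < 1" and p: "p \<le> 1/2"
  defines "x \<equiv> q * p / (1 - p)"
  shows "\<bar>a n - exp (- (real n * x))\<bar> \<le> 3 * p + 2 * q * m"
proof -
  define r where "r = 1 - q * p"
  have qp: "0 < q * p" "q * p < 1" using q_pos p_pos q p mult_strict_mono[of q 1 p 1] by auto
  have r: "0 \<le> r" "r \<le> 1" using qp by (auto simp: r_def)
  have x: "0 < x" "x \<le> 2 * (q * p)" "x - q * p = p * x"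
    using qp p mult_left_mono[of p "1/2" "q*p"] by (auto simp: x_def field_simps)
  have x1: "x \<le> 1" using q q_pos p p_pos mult_mono[of q 1 p "1/2"] x by auto
  have "\<bar>a n - r ^ n\<bar> \<le> (\<Sum>t<n. \<bar>w (Suc t) + q * ((\<Sum>i\<le>t. w i * a (t - i)) - p * a t)\<bar>)"
  proof (rule perturbed_geometric[where x = a, OF a_0 _ r])
    show "a (Suc t) = r * a t - (w (Suc t) + q * ((\<Sum>i\<le>t. w i * a (t - i)) - p * a t))" for t
      using a_rec[of t] by (simp add: r_def algebra_simps)
  qed
  also have "\<dots> \<le> (\<Sum>t<n. w (Suc t)) + q * (\<Sum>t<n. \<bar>(\<Sum>i\<le>t. w i * a (t - i)) - p * a t\<bar>)"
    unfolding sum_distrib_left sum.distrib[symmetric] using q_pos w_nonneg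
    by (intro sum_mono order_trans[OF abs_triangle_ineq]) (auto simp: abs_mult)
  also have "(\<Sum>t<n. w (Suc t)) \<le> p"
    using sum_w_le[of "Suc ` {..<n}"] by (simp add: sum.reindex)
  also have "q * (\<Sum>t<n. \<bar>(\<Sum>i\<le>t. w i * a (t - i)) - p * a t\<bar>) \<le> q * (2 * m)"
    using q_pos by (intro mult_left_mono sum_convolution_deviation_le) auto
  finally have 1: "\<bar>a n - r ^ n\<bar> \<le> p + 2 * q * m" by simp
  \<comment> \<open>Both numbers lie between \<open>1 - x\<close> and \<open>r\<close>, and this
    interval has length \<open>x - q * p = p * x\<close>.\<close>
  have e: "\<bar>r - exp (- x)\<bar> \<le> p * x"
  proof -
    have "exp (- x) \<ge> 1 - x" using exp_ge_add_one_self[of "- x"] by simp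
    moreover have "exp (- x) \<le> r"
    proof -
      have "1 + x \<le> exp x" by (rule exp_ge_add_one_self)
      then have "exp (- x) \<le> 1 / (1 + x)" using x by (simp add: exp_minus field_simps)
      also have "1 + x = (1 - p + q * p) / (1 - p)" using p by (simp add: x_def field_simps)
      also have "1 / \<dots> \<le> r"
      proof -
        \<comment> \<open>The right side exceeds the left by exactly
          \<open>q * p * (p * (1 - q))\<close>.\<close>
        have "1 - p \<le> (1 - q * p) * (1 - p + q * p)"
          using qp p_pos q_pos q mult_nonneg_nonneg[of "q * p" "p * (1 - q)"] by (simp add: algebra_simps)
        then show ?thesis using qp p by (simp add: r_def divide_le_eq)
      qed
      finally show ?thesis .
    qed
    ultimately show ?thesis using x by (simp add: r_def)
  qed
  \<comment> \<open>Now the exponential plays the perturbed sequence. Its perturbations decay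
    geometrically with sum at most \<open>p * x * (2 / x)\<close>, so the bound does not grow with
    \<open>n\<close>.\<close>
  have "\<bar>exp (- (real n * x)) - r ^ n\<bar> \<le> (\<Sum>t<n. \<bar>(r - exp (- x)) * exp (- (real t * x))\<bar>)"
  proof (rule perturbed_geometric[OF _ _ r])
    fix t
    have "exp (- (real (Suc t) * x)) = exp (- x) * exp (- (real t * x))"
      by (simp add: mult_exp_exp algebra_simps)
    then show "exp (- (real (Suc t) * x)) =
        r * exp (- (real t * x)) - (r - exp (- x)) * exp (- (real t * x))"
      by (simp add: left_diff_distrib)
  qed simp
  also have "\<dots> = \<bar>r - exp (- x)\<bar> * (\<Sum>t<n. exp (- x) ^ t)"
    by (simp add: abs_mult sum_distrib_left exp_of_nat_mult[symmetric])
  also have "(\<Sum>t<n. exp (- x) ^ t) \<le> 1 / (1 - exp (- x))"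
    using sum_le_suminf[of "\<lambda>t. exp (- x) ^ t" "{..<n}"] suminf_geometric[of "exp (- x)"]
      summable_geometric[of "exp (- x)"] x by simp
  also have "\<dots> \<le> 2 / x"
    using one_minus_exp_ge[of x] x x1 by (simp add: field_simps)
  finally have "\<bar>exp (- (real n * x)) - r ^ n\<bar> \<le> \<bar>r - exp (- x)\<bar> * (2 / x)"
    by (simp add: mult_left_mono)
  also have "\<dots> \<le> (p * x) * (2 / x)" using e x by (intro mult_right_mono) auto
  also have "\<dots> = 2 * p" using x by simp
  finally show ?thesis using 1 by linarith
qed


text \<open>Closeness of \<open>a\<close> to the exponential forces \<open>h\<close>, the transform
  of \<open>w\<close> at \<open>z = exp (- x)\<close>, to be close to \<open>p\<close> relative to
  \<open>p\<close>. Since \<open>p - h\<close> is of order \<open>x * m\<close> up to a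
  second-moment error, this bounds \<open>m\<close>; the second moment enters through
  \<open>K\<close>.\<close>

lemma mean_le_of_near_exp:
  assumes q: "q < 1" and p: "p \<le> 1/2"
  defines "x \<equiv> q * p / (1 - p)"
  assumes near: "\<And>t. \<bar>a t - exp (- (real t * x))\<bar> \<le> d"
    and second: "summable (\<lambda>k. (real k)\<^sup>2 * w k)" and K: "(\<Sum>k. (real k)\<^sup>2 * w k) \<le> K"
  shows "q * m \<le> 8 * d + (16 + K) * p"
proof -
  define z where "z = exp (- x)"
  define h where "h = (\<Sum>k. w k * z ^ k)"
  have qp: "0 < q * p" "q * p < 1" using q_pos p_pos q p mult_strict_mono[of q 1 p 1] by auto
  have x: "0 < x" "q * p \<le> x" "x \<le> 2 * (q * p)"
    using qp p mult_left_mono[of p "1/2" "q*p"] p_pos by (auto simp: x_def field_simps)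
  have z: "0 < z" "z < 1" "1 - z \<le> x" using x exp_ge_add_one_self[of "- x"] by (auto simp: z_def)
  have sw: "summable (\<lambda>k. w k * z ^ k)"
    using summable_times_power[OF sums_summable[OF w_sums] w_nonneg] z by simp
  have h: "(\<lambda>k. w k * z ^ k) sums h" using sw by (simp add: h_def summable_sums)
  have h0: "0 \<le> h" unfolding h_def using w_nonneg z by (intro suminf_nonneg sw) auto
  have hp: "h \<le> p"
  proof (rule sums_le[OF _ h w_sums])
    show "w k * z ^ k \<le> w k" for k
      using mult_left_mono[OF power_le_one[of z k] w_nonneg[of k]] z by simp
  qed
  have m_le: "m \<le> 2 / (q * p) * (p - h) + q * p * K"
  proof -
    have "m \<le> 2 / (q * p) * (p - h) + q * p * (\<Sum>k. (real k)\<^sup>2 * w k)"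
    proof (rule sums_le[OF _ mean_sums])
      show "(\<lambda>k. 2 / (q * p) * (w k - w k * z ^ k) + q * p * ((real k)\<^sup>2 * w k)) sums
          (2 / (q * p) * (p - h) + q * p * (\<Sum>k. (real k)\<^sup>2 * w k))"
        by (intro sums_add sums_mult sums_diff w_sums h summable_sums second)
      fix k
      have zk: "z ^ k = exp (- (real k * x))" by (simp add: z_def exp_of_nat_mult[symmetric])
      \<comment> \<open>For \<open>k * q * p \<le> 1\<close> the first term suffices, because
        \<open>1 - exp (- y) \<ge> y / 2\<close> on the unit interval; for larger \<open>k\<close>
        the quadratic term alone exceeds \<open>k\<close>.\<close>
      have "real k \<le> 2 / (q * p) * (1 - z ^ k) + q * p * (real k)\<^sup>2"
      proof (cases "real k * (q * p) \<le> 1")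
        case True
        have "real k * (q * p) / 2 \<le> 1 - exp (- (real k * (q * p)))"
          using True qp by (intro one_minus_exp_ge) auto
        also have "\<dots> \<le> 1 - z ^ k" using x by (auto simp: zk mult_left_mono)
        finally have "real k \<le> 2 / (q * p) * (1 - z ^ k)" using qp by (simp add: field_simps)
        also have "\<dots> \<le> \<dots> + q * p * (real k)\<^sup>2" using qp by simp
        finally show ?thesis .
      next
        case False
        then have "real k * 1 \<le> real k * (real k * (q * p))" by (intro mult_left_mono) auto
        moreover have "0 \<le> 2 / (q * p) * (1 - z ^ k)" using qp z by (simp add: power_le_one)
        ultimately show ?thesis by (simp add: power2_eq_square ac_simps)
      qed
      from mult_right_mono[OF this w_nonneg[of k]]
      have "real k * w k \<le> (2 / (q * p) * (1 - z ^ k) + q * p * (real k)\<^sup>2) * w k" .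
      also have "\<dots> = 2 / (q * p) * (w k - w k * z ^ k) + q * p * ((real k)\<^sup>2 * w k)"
        unfolding distrib_right right_diff_distrib left_diff_distrib by (simp add: ac_simps)
      finally show "real k * w k \<le> 2 / (q * p) * (w k - w k * z ^ k) + q * p * ((real k)\<^sup>2 * w k)" .
    qed
    also have "q * p * (\<Sum>k. (real k)\<^sup>2 * w k) \<le> q * p * K" using K qp by (intro mult_left_mono) auto
    finally show ?thesis by simp
  qed
  define A where "A = (\<Sum>k. a k * z ^ k)"
  have A: "(\<lambda>k. a k * z ^ k) sums A"
    using summable_times_power[OF summable_a a_nonneg] z by (simp add: A_def summable_sums)
  have geo: "(\<lambda>k. (z ^ k)) sums (1 / (1 - z))" using z by (intro geometric_sums) auto
  have zz: "\<bar>z * z\<bar> < 1" using z mult_strict_mono[of z 1 z 1] by (simp add: abs_mult)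
  \<comment> \<open>If \<open>a k\<close> were exactly \<open>z ^ k\<close>, then \<open>A\<close>
    would be \<open>1 / (1 - z * z)\<close>. Only the upper estimate of \<open>a\<close> is used
    from here on.\<close>
  have "A - 1 / (1 - z * z) \<le> d * (1 / (1 - z))"
  proof (rule sums_le)
    show "(\<lambda>k. a k * z ^ k - (z * z) ^ k) sums (A - 1 / (1 - z * z))"
      using zz by (intro sums_diff A geometric_sums) simp
    show "(\<lambda>k. d * z ^ k) sums (d * (1 / (1 - z)))" by (intro sums_mult geo)
    fix k
    have "a k - z ^ k \<le> d" using near[of k] by (simp add: z_def exp_of_nat_mult[symmetric])
    then have "(a k - z ^ k) * z ^ k \<le> d * z ^ k" using z by (intro mult_right_mono) auto
    then show "a k * z ^ k - (z * z) ^ k \<le> d * z ^ k" by (simp add: algebra_simps power_mult_distrib)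
  qed
  then have "(A - 1 / (1 - z * z)) * (1 - z) \<le> d" using z by (simp add: field_simps)
  moreover have "1 / (1 - z * z) * (1 - z) = 1 / (1 + z)"
  proof -
    have "1 - z * z = (1 + z) * (1 - z)" by (simp add: algebra_simps)
    then show ?thesis using z by simp
  qed
  ultimately have d1: "A * (1 - z) - 1 / (1 + z) \<le> d" by (simp only: left_diff_distrib)
  \<comment> \<open>With this ratio the generating function identity becomes
    \<open>A * (1 - z) = (1 - h) / (1 + \<rho>)\<close>. As \<open>A * (1 - z)\<close> exceeds a
    number near 1/2 by at most \<open>d\<close>, \<rho> cannot fall far below 1.\<close>
  define \<rho> where "\<rho> = q * z * h / (1 - z)"
  have gf: "A * (1 - z + q * z * h) = 1 - h"
    using generating_function[of z] z by (simp add: A_def h_def)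
  have \<rho>0: "0 \<le> \<rho>" using z q_pos h0 by (simp add: \<rho>_def)
  have "1 - z + q * z * h = (1 - z) * (1 + \<rho>)" using z by (simp add: \<rho>_def field_simps)
  then have "A * (1 - z) * (1 + \<rho>) = 1 - h" using gf by (simp add: mult.assoc)
  then have A_eq: "A * (1 - z) = (1 - h) / (1 + \<rho>)" using \<rho>0 by (simp add: eq_divide_eq)
  \<comment> \<open>Equivalent to \<open>z * (1 + x) \<le> 1\<close>. Together with
    \<open>q * p \<le> x\<close> it yields \<open>\<rho> \<le> h / p\<close>, so a lower bound on
    \<rho> becomes one on \<open>h / p\<close>.\<close>
  have "z / (1 - z) \<le> 1 / x"
  proof -
    have "z * (1 + x) \<le> z * exp x" using z by (intro mult_left_mono) (auto simp: exp_ge_add_one_self)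
    also have "\<dots> = 1" by (simp add: z_def exp_minus)
    finally show ?thesis using x z by (simp add: field_simps)
  qed
  then have "q * h * (z / (1 - z)) \<le> q * h * (1 / x)" using q_pos h0 by (intro mult_left_mono) auto
  also have "\<dots> \<le> q * h * (1 / (q * p))"
    using q_pos h0 x qp by (intro mult_left_mono divide_left_mono) auto
  finally have \<rho>_le: "\<rho> \<le> h / p" using q_pos by (simp add: \<rho>_def ac_simps)
  then have \<rho>1: "\<rho> \<le> 1" using hp p_pos by (smt (verit) divide_le_eq_1)
  \<comment> \<open>The convex function \<open>1 / (1 + \<rho>)\<close> lies above its tangent at
    \<open>\<rho> = 1\<close>.\<close>
  have "(1 - \<rho>) / 4 \<le> 1 / (1 + \<rho>) - 1 / 2"
  proof -
    have "0 \<le> (1 - \<rho>) * (1 - \<rho>)" by simp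
    then show ?thesis using \<rho>0 by (simp add: field_simps)
  qed
  moreover have "1 / (1 + z) \<le> 1 / 2 + x / 2"
  proof -
    have "1 / (1 + z) - 1 / 2 = (1 - z) * (1 / (2 * (1 + z)))" using z by (simp add: field_simps)
    also have "\<dots> \<le> (1 - z) * (1 / 2)" using z by (intro mult_left_mono) (auto simp: field_simps)
    finally show ?thesis using z by simp
  qed
  moreover have "1 / (1 + \<rho>) - h \<le> (1 - h) / (1 + \<rho>)"
  proof -
    have "h / (1 + \<rho>) \<le> h" using h0 \<rho>0 by (simp add: divide_le_eq mult_le_cancel_left1)
    then show ?thesis by (simp add: diff_divide_distrib)
  qed
  ultimately have quarter: "(1 - \<rho>) / 4 \<le> d + x / 2 + p" using d1 A_eq hp by linarith
  have ge: "(p - h) / p \<le> 1 - \<rho>" using \<rho>_le p_pos by (simp add: diff_divide_distrib)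
  have "x \<le> 2 * p" using x q p_pos mult_right_mono[of q 1 p] by linarith
  with quarter have "1 - \<rho> \<le> 4 * d + 8 * p" by (simp add: field_simps)
  then have ph: "(p - h) / p \<le> 4 * d + 8 * p" using ge order_trans by blast
  have K0: "0 \<le> K" using K suminf_nonneg[OF second] w_nonneg by fastforce
  have "q * m \<le> q * (2 / (q * p) * (p - h) + q * p * K)" using m_le q_pos by simp
  also have "\<dots> = 2 * ((p - h) / p) + (q * q) * (p * K)" using q_pos p_pos by (simp add: field_simps)
  also have "(q * q) * (p * K) \<le> 1 * (p * K)"
    using q q_pos p_pos K0 by (intro mult_right_mono) (auto intro: mult_le_one)
  finally have "q * m \<le> 2 * ((p - h) / p) + 1 * (p * K)" by simp
  also have "2 * ((p - h) / p) \<le> 2 * (4 * d + 8 * p)" using ph by (rule mult_left_mono) simp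
  finally show ?thesis by (simp add: algebra_simps)
qed

end

subsection \<open>The tail of the completion time\<close>

definition succeeds :: "nat \<times> nat \<Rightarrow> bool" where
  "succeeds x \<longleftrightarrow> fst x < snd x"

lemma measurable_attempt:
  "(\<lambda>\<omega>. f (\<omega> i)) \<in> measurable (attempts q D) (count_space UNIV)"
proof -
  have "(\<lambda>\<omega>. f (\<omega> i)) \<in>
      measurable (PiM UNIV (\<lambda>_::nat. count_space (UNIV :: (nat \<times> nat) set))) (count_space UNIV)"
    by (rule measurable_compose[OF measurable_component_singleton[of i]]) auto
  then show ?thesis by (simp add: measurable_cong_sets[OF sets_attempts refl])
qed

lemma measurable_completion_time_attempts [measurable]:
  "completion_time \<in> measurable (attempts q D) (count_space UNIV)"
  using measurable_completion_time by (simp add: measurable_cong_sets[OF sets_attempts refl])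

lemma prob_space_attempts: "prob_space (attempts q D)"
  unfolding attempts_def by (intro prob_space_PiM prob_space_measure_pmf)

text \<open>Conditioning on the first attempt: a sequence of independent attempts is its first
  coordinate followed by an independent sequence with the same law.\<close>

lemma nn_integral_attempts:
  assumes f [measurable]: "f \<in> borel_measurable (attempts q D)"
  shows "(\<integral>\<^sup>+\<omega>. f \<omega> \<partial>attempts q D) =
    (\<integral>\<^sup>+x. (\<integral>\<^sup>+\<omega>. f (case_nat x \<omega>) \<partial>attempts q D) \<partial>pair_pmf D (catastrophe_pmf q))"
proof -
  let ?M = "measure_pmf (pair_pmf D (catastrophe_pmf q))"
  interpret S: sequence_space ?M by unfold_locales
  have [measurable]: "f \<in> borel_measurable S.S" using f by (simp add: attempts_def)
  have "(\<integral>\<^sup>+\<omega>. f \<omega> \<partial>S.S) = (\<integral>\<^sup>+\<omega>. f \<omega> \<partial>distr (?M \<Otimes>\<^sub>M S.S) S.S (\<lambda>(s, \<omega>). case_nat s \<omega>))"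
    by (simp only: S.PiM_iter)
  also have "\<dots> = (\<integral>\<^sup>+y. f (case_nat (fst y) (snd y)) \<partial>(?M \<Otimes>\<^sub>M S.S))"
    by (subst nn_integral_distr) (auto simp: split_beta')
  also have "\<dots> = (\<integral>\<^sup>+x. (\<integral>\<^sup>+\<omega>. f (case_nat x \<omega>) \<partial>S.S) \<partial>?M)"
    by (subst S.nn_integral_fst[symmetric]) (auto simp: split_beta')
  finally show ?thesis by (simp only: attempts_def)
qed

text \<open>After a failed first attempt the index of the first success shifts by one. The
  assumption ensures that the \<open>LEAST\<close> index of the remaining sequence is a genuine
  success.\<close>

lemma completion_time_case_nat:
  assumes "\<exists>i. succeeds (\<omega> i)"
  shows "completion_time (case_nat x \<omega>) =
    min (fst x) (snd x) + (if succeeds x then 0 else completion_time \<omega>)"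
proof (cases "succeeds x")
  case True
  then have "first_success (case_nat x \<omega>) = 0"
    unfolding first_success_def succeeds_def by (intro Least_equality) auto
  then show ?thesis using True by (simp add: completion_time_def)
next
  case False
  obtain i where i: "fst (\<omega> i) < snd (\<omega> i)" using assms by (auto simp: succeeds_def)
  have "first_success (case_nat x \<omega>) = Suc (first_success \<omega>)"
    unfolding first_success_def
    using Least_Suc[of "\<lambda>i. fst (case_nat x \<omega> i) < snd (case_nat x \<omega> i)" "Suc i"] i False
    by (simp add: succeeds_def)
  then show ?thesis using False by (simp add: completion_time_def sum.atMost_Suc_shift del: sum.atMost_Suc)
qed

lemma pmf_catastrophe_Suc:
  assumes "0 < q" "q < 1"
  shows "pmf (catastrophe_pmf q) (Suc t) = (1 - q) ^ t * q"
  using assms pmf_map_inj'[of Suc "geometric_pmf q" t] by (simp add: catastrophe_pmf_def)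

text \<open>The event \<open>N\<close> of no success means a failed first attempt followed by
  \<open>N\<close> for the rest, so \<open>prob N\<close> equals itself times the failure
  probability. The latter is not 1: for \<open>n\<close> in the support of \<open>D\<close>, the
  successful pair \<open>(n, Suc n)\<close> has positive probability.\<close>

lemma AE_attempts_success:
  assumes q: "0 < q" "q < 1"
  shows "AE \<omega> in attempts q D. \<exists>i. succeeds (\<omega> i)"
proof -
  interpret prob_space "attempts q D" by (rule prob_space_attempts)
  let ?M = "pair_pmf D (catastrophe_pmf q)"
  define N where "N = {\<omega> \<in> space (attempts q D). \<forall>i. \<not> succeeds (\<omega> i)}"
  have [measurable]: "Measurable.pred (attempts q D) (\<lambda>\<omega>. succeeds (\<omega> i))" for i
    by (rule measurable_attempt)
  have N [measurable]: "N \<in> sets (attempts q D)" unfolding N_def by measurable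
  have sp: "space (attempts q D) = UNIV"
    using sets_eq_imp_space_eq[OF sets_attempts] by (simp add: space_PiM)
  have ind: "indicator N (case_nat x \<omega>) = (indicator {x. \<not> succeeds x} x * indicator N \<omega> :: ennreal)" for x \<omega>
  proof -
    have "(\<forall>i. \<not> succeeds (case_nat x \<omega> i)) \<longleftrightarrow> \<not> succeeds x \<and> (\<forall>i. \<not> succeeds (\<omega> i))"
      by (auto split: nat.split intro: allE[of _ 0] dest: spec[of _ "Suc _"])
    then show ?thesis by (simp add: N_def sp indicator_def)
  qed
  have "emeasure (attempts q D) N = (\<integral>\<^sup>+\<omega>. indicator N \<omega> \<partial>attempts q D)" by simp
  also have "\<dots> = (\<integral>\<^sup>+x. (\<integral>\<^sup>+\<omega>. indicator N (case_nat x \<omega>) \<partial>attempts q D) \<partial>?M)"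
    by (rule nn_integral_attempts) measurable
  also have "\<dots> = emeasure ?M {x. \<not> succeeds x} * emeasure (attempts q D) N"
    by (simp add: ind nn_integral_cmult nn_integral_multc)
  finally have eq: "prob N = measure_pmf.prob ?M {x. \<not> succeeds x} * prob N"
    by (simp add: emeasure_eq_measure measure_pmf.emeasure_eq_measure ennreal_mult'[symmetric])
  obtain n where n: "n \<in> set_pmf D" using set_pmf_not_empty[of D] by blast
  have "(n, Suc n) \<in> set_pmf ?M"
    using n q by (auto simp: set_pmf_iff[of "Suc n"] pmf_catastrophe_Suc)
  then have "measure_pmf.prob ?M {x. \<not> succeeds x} \<noteq> 1"
    by (subst measure_pmf.prob_eq_1) (auto simp: AE_measure_pmf_iff succeeds_def)
  with eq have "prob N = 0" by simp
  then have "AE \<omega> in attempts q D. \<omega> \<notin> N"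
    by (intro AE_not_in) (simp add: null_sets_def emeasure_eq_measure N)
  then show ?thesis by (auto simp: N_def sp)
qed

definition completion_tail :: "real \<Rightarrow> nat pmf \<Rightarrow> nat \<Rightarrow> real" where
  "completion_tail q D t = measure (attempts q D) {\<omega> \<in> space (attempts q D). t < completion_time \<omega>}"

text \<open>Either the first attempt lasts beyond \<open>t\<close>, or a catastrophe ends it at step
  \<open>Suc j \<le> t\<close> and the restarted process must outlast \<open>t - Suc j\<close>. A
  success by time \<open>t\<close> contributes nothing.\<close>

lemma completion_tail_renewal:
  assumes q: "0 < q" "q < 1"
  shows "completion_tail q D t = (1 - q) ^ t * measure_pmf.prob D {t<..} +
    q * (\<Sum>j<t. (1 - q) ^ j * measure_pmf.prob D {j<..} * completion_tail q D (t - Suc j))"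
proof -
  interpret prob_space "attempts q D" by (rule prob_space_attempts)
  let ?M = "pair_pmf D (catastrophe_pmf q)"
  let ?a = "completion_tail q D"
  have sp: "space (attempts q D) = UNIV"
    using sets_eq_imp_space_eq[OF sets_attempts] by (simp add: space_PiM)
  have gt_sets [measurable]: "{\<omega>. t < completion_time \<omega>} \<in> sets (attempts q D)" for t
  proof -
    have "{\<omega> \<in> space (attempts q D). t < completion_time \<omega>} \<in> sets (attempts q D)" by measurable
    then show ?thesis by (simp add: sp)
  qed
  have a: "(\<integral>\<^sup>+\<omega>. indicator {\<omega>. t < completion_time \<omega>} \<omega> \<partial>attempts q D) = ennreal (?a t)" for t
    by (simp add: completion_tail_def sp emeasure_eq_measure)
  have a0: "0 \<le> ?a t" for t by (simp add: completion_tail_def)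
  have gt: "{x. t < min (fst x) (snd x)} = {t<..} \<times> {t<..}" by auto
  have eq: "{x. snd x = Suc j \<and> \<not> succeeds x} = {j<..} \<times> {Suc j}" for j
    by (auto simp: succeeds_def)
  have prod: "measure_pmf.prob ?M (A \<times> B) = measure_pmf.prob D A * measure_pmf.prob (catastrophe_pmf q) B" for A B
    by (rule measure_pmf_prob_product) auto
  have int1: "integrable ?M (indicat_real A)" for A
    by (rule measure_pmf.integrable_const_bound[of _ 1]) (auto simp: indicator_def)
  have int2: "integrable ?M (\<lambda>x. \<Sum>j<t. indicat_real {x. snd x = Suc j \<and> \<not> succeeds x} x * ?a (t - Suc j))"
    by (intro Bochner_Integration.integrable_sum integrable_mult_left int1)
  have "ennreal (?a t) = (\<integral>\<^sup>+x. (\<integral>\<^sup>+\<omega>. indicator {\<omega>. t < completion_time \<omega>} (case_nat x \<omega>) \<partial>attempts q D) \<partial>?M)"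
    unfolding a[symmetric] by (rule nn_integral_attempts) measurable
  also have "\<dots> = (\<integral>\<^sup>+x. ennreal (indicator {x. t < min (fst x) (snd x)} x +
      (\<Sum>j<t. indicator {x. snd x = Suc j \<and> \<not> succeeds x} x * ?a (t - Suc j))) \<partial>?M)"
  proof (rule nn_integral_cong_AE, unfold AE_measure_pmf_iff, rule ballI)
    fix x assume "x \<in> set_pmf ?M"
    \<comment> \<open>Catastrophe times start at 1, so a failed attempt always matches some
      \<open>Suc j\<close>.\<close>
    then have x: "0 < snd x" by (auto simp: catastrophe_pmf_def)
    have "(\<integral>\<^sup>+\<omega>. indicator {\<omega>. t < completion_time \<omega>} (case_nat x \<omega>) \<partial>attempts q D) =
      (\<integral>\<^sup>+\<omega>. indicator {\<omega>. t < min (fst x) (snd x) + (if succeeds x then 0 else completion_time \<omega>)} \<omega> \<partial>attempts q D)"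
      by (rule nn_integral_cong_AE[OF eventually_mono[OF AE_attempts_success[OF q]]])
        (simp add: completion_time_case_nat indicator_def)
    also have "\<dots> = ennreal (indicator {x. t < min (fst x) (snd x)} x +
      (\<Sum>j<t. indicator {x. snd x = Suc j \<and> \<not> succeeds x} x * ?a (t - Suc j)))"
    proof (cases "t < min (fst x) (snd x)")
      case True
      then have "indicator {x. snd x = Suc j \<and> \<not> succeeds x} x = (0::real)" if "j < t" for j
        using that by auto
      then show ?thesis using True
        by (auto simp: emeasure_space_1 trans_less_add1)
    next
      case False
      show ?thesis
      proof (cases "succeeds x")
        case True
        then show ?thesis using False by simp
      next
        case fail: False
        \<comment> \<open>A failed attempt ends at its catastrophe time, so exactly one summand,
          \<open>j = i\<close>, survives.\<close>
        with False x obtain i where i: "snd x = Suc i" "i < t" "min (fst x) (snd x) = Suc i"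
          by (cases "snd x") (auto simp: succeeds_def)
        have "(\<Sum>j<t. indicator {x. snd x = Suc j \<and> \<not> succeeds x} x * ?a (t - Suc j)) =
          (\<Sum>j<t. if i = j then ?a (t - Suc j) else 0)"
          using i fail by (intro sum.cong) auto
        also have "\<dots> = ?a (t - Suc i)" using i by simp
        finally have "indicator {x. t < min (fst x) (snd x)} x +
          (\<Sum>j<t. indicator {x. snd x = Suc j \<and> \<not> succeeds x} x * ?a (t - Suc j)) = ?a (t - Suc i)"
          using i by simp
        moreover have "{\<omega>. t < min (fst x) (snd x) + (if succeeds x then 0 else completion_time \<omega>)} =
          {\<omega>. t - Suc i < completion_time \<omega>}"
          using i fail by auto
        ultimately show ?thesis by (simp only: a)
      qed
    qed
    finally show "(\<integral>\<^sup>+\<omega>. indicator {\<omega>. t < completion_time \<omega>} (case_nat x \<omega>) \<partial>attempts q D) =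
      ennreal (indicator {x. t < min (fst x) (snd x)} x +
      (\<Sum>j<t. indicator {x. snd x = Suc j \<and> \<not> succeeds x} x * ?a (t - Suc j)))" .
  qed
  also have "\<dots> = ennreal (\<integral>x. indicator {x. t < min (fst x) (snd x)} x +
      (\<Sum>j<t. indicator {x. snd x = Suc j \<and> \<not> succeeds x} x * ?a (t - Suc j)) \<partial>?M)"
    by (intro nn_integral_eq_integral Bochner_Integration.integrable_add int1 int2 AE_I2
        add_nonneg_nonneg sum_nonneg mult_nonneg_nonneg a0 indicator_pos_le)
  also have "(\<integral>x. indicator {x. t < min (fst x) (snd x)} x +
      (\<Sum>j<t. indicator {x. snd x = Suc j \<and> \<not> succeeds x} x * ?a (t - Suc j)) \<partial>?M) =
      measure_pmf.prob ?M ({t<..} \<times> {t<..}) + (\<Sum>j<t. measure_pmf.prob ?M ({j<..} \<times> {Suc j}) * ?a (t - Suc j))"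
  proof -
    have "(\<integral>x. (\<Sum>j<t. indicat_real {x. snd x = Suc j \<and> \<not> succeeds x} x * ?a (t - Suc j)) \<partial>?M) =
        (\<Sum>j<t. \<integral>x. indicat_real {x. snd x = Suc j \<and> \<not> succeeds x} x * ?a (t - Suc j) \<partial>?M)"
      by (intro Bochner_Integration.integral_sum integrable_mult_left int1)
    also have "\<dots> = (\<Sum>j<t. measure_pmf.prob ?M ({j<..} \<times> {Suc j}) * ?a (t - Suc j))"
      by (simp add: eq)
    finally show ?thesis
      unfolding Bochner_Integration.integral_add[OF int1 int2] gt by simp
  qed
  also have "\<dots> = (1 - q) ^ t * measure_pmf.prob D {t<..} +
    q * (\<Sum>j<t. (1 - q) ^ j * measure_pmf.prob D {j<..} * ?a (t - Suc j))"
    unfolding prod catastrophe_pmf_tail[OF q]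
    by (simp add: measure_pmf_single pmf_catastrophe_Suc[OF q] sum_distrib_left ac_simps)
  finally show ?thesis
    by (subst (asm) ennreal_inj) (auto intro!: add_nonneg_nonneg mult_nonneg_nonneg sum_nonneg a0 simp: q less_imp_le)
qed

subsection \<open>Probability generating functions and the Kolmogorov distance\<close>

lemma expectation_nat_pmf_sums:
  fixes f :: "nat \<Rightarrow> real"
  assumes "\<And>n. \<bar>f n\<bar> \<le> B"
  shows "(\<lambda>n. pmf D n * f n) sums measure_pmf.expectation D f"
proof -
  have "integrable (measure_pmf D) f"
    using assms by (intro measure_pmf.integrable_const_bound[of _ B]) auto
  then have int: "integrable (count_space UNIV) (\<lambda>n. pmf D n * f n)"
    unfolding measure_pmf_eq_density by (subst (asm) integrable_density) auto
  have "measure_pmf.expectation D f = (\<integral>n. pmf D n * f n \<partial>count_space UNIV)"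
    unfolding measure_pmf_eq_density by (subst integral_density) auto
  then show ?thesis using sums_integral_count_space_nat[OF int] by simp
qed

lemma pgf_sums:
  assumes "\<bar>z\<bar> \<le> 1"
  shows "(\<lambda>n. pmf D n * z ^ n) sums pgf D z"
  unfolding pgf_def
  by (rule expectation_nat_pmf_sums[of _ 1]) (use assms in \<open>auto simp: power_abs power_le_one\<close>)

text \<open>The series converges at 1, hence may be differentiated termwise inside the unit
  interval; the factor \<open>z\<close> restores the exponents.\<close>

lemma deriv_pgf_sums:
  assumes "\<bar>z\<bar> < 1"
  shows "(\<lambda>n. real n * (pmf D n * z ^ n)) sums (z * deriv (pgf D) z)"
proof -
  let ?f' = "\<Sum>n. diffs (pmf D) n * z ^ n"
  have summable: "summable (\<lambda>n. pmf D n * 1 ^ n)"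
    using pgf_sums[of 1 D] by (simp add: sums_iff)
  have "((\<lambda>y. \<Sum>n. pmf D n * y ^ n) has_real_derivative ?f') (at z)"
    by (rule termdiffs_strong[OF summable]) (use assms in simp)
  then have "(pgf D has_real_derivative ?f') (at z)"
  proof (rule has_field_derivative_transform_within_open)
    show "(\<Sum>n. pmf D n * y ^ n) = pgf D y" if "y \<in> {-1<..<1}" for y
      using pgf_sums[of y D] that by (auto simp: sums_iff)
  qed (use assms in auto)
  then have d: "deriv (pgf D) z = ?f'" by (rule DERIV_imp_deriv)
  have "summable (\<lambda>n. diffs (pmf D) n * z ^ n)"
  proof (rule termdiff_converges[of _ 1])
    show "summable (\<lambda>n. pmf D n * y ^ n)" if "norm y < 1" for y
      using pgf_sums[of y D] that by (auto simp: sums_iff)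
  qed (use assms in simp)
  from sums_mult[OF diffs_equiv[OF this], of z]
  have "(\<lambda>n. z * (real n * pmf D n * z ^ (n - Suc 0))) sums (z * deriv (pgf D) z)"
    by (simp add: d)
  moreover have "z * (real n * pmf D n * z ^ (n - Suc 0)) = real n * (pmf D n * z ^ n)" for n
    by (cases n) (simp_all add: algebra_simps)
  ultimately show ?thesis by simp
qed

text \<open>The expression is the square of \<open>n * sqrt s ^ n\<close>, which tends to 0. It
  supplies a second-moment bound that depends on \<open>s\<close> alone and not on the law of the
  base time.\<close>

lemma square_times_power_bounded:
  fixes s :: real
  assumes "0 \<le> s" "s < 1"
  obtains K where "0 < K" "\<And>n. (real n)\<^sup>2 * s ^ n \<le> K"
proof -
  have "(\<lambda>n. real n * sqrt s ^ n) \<longlonglongrightarrow> 0"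
    by (rule powser_times_n_limit_0) (use assms in simp)
  then have "Bseq (\<lambda>n. real n * sqrt s ^ n)" by (rule convergent_imp_Bseq[OF convergentI])
  then obtain L where L: "0 < L" "\<And>n. norm (real n * sqrt s ^ n) \<le> L" by (auto elim: BseqE)
  show ?thesis
  proof (rule that)
    show "0 < L\<^sup>2" using L by simp
    fix n
    have "(real n)\<^sup>2 * s ^ n = (norm (real n * sqrt s ^ n))\<^sup>2"
      using assms by (simp add: power_mult_distrib power_mult[symmetric] power_commutes mult.commute[of n 2]
          power_mult)
    also have "\<dots> \<le> L\<^sup>2" using L(2)[of n] by (intro power_mono) auto
    finally show "(real n)\<^sup>2 * s ^ n \<le> L\<^sup>2" .
  qed
qed

section \<open>The tail of the completion time as a defective renewal sequence\<close>

lemma decseq_completion_tail: "decseq (completion_tail q D)"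
proof (rule decseq_SucI)
  interpret prob_space "attempts q D" by (rule prob_space_attempts)
  show "completion_tail q D (Suc t) \<le> completion_tail q D t" for t
    unfolding completion_tail_def by (intro finite_measure_mono) auto
qed

text \<open>Let \<open>u j\<close> be the probability that one attempt lasts more than
  \<open>j\<close> steps. It satisfies \<open>u (Suc j) = (1 - q) * u j - w (Suc j)\<close>;
  inserting this into the renewal equation at \<open>Suc t\<close> leaves a multiple of the equation
  at \<open>t\<close>.\<close>

lemma completion_tail_rec:
  assumes q: "0 < q" "q < 1" and D: "0 \<notin> set_pmf D"
  defines "a \<equiv> completion_tail q D" and "w \<equiv> \<lambda>k. pmf D k * (1 - q) ^ k"
  shows "a 0 = 1"
    and "a t - a (Suc t) = w (Suc t) + q * (\<Sum>i\<le>t. w i * a (t - i))"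
proof -
  define u where "u j = (1 - q) ^ j * measure_pmf.prob D {j<..}" for j
  have w0: "w 0 = 0" using D by (simp add: w_def set_pmf_iff)
  have u0: "u 0 = 1"
    using D by (auto simp: u_def measure_pmf.prob_eq_1 AE_measure_pmf_iff intro!: gr0I)
  have u_Suc: "u (Suc j) = (1 - q) * u j - w (Suc j)" for j
  proof -
    have "{j<..} = {Suc j} \<union> {Suc j<..}" by auto
    then have "measure_pmf.prob D {j<..} = pmf D (Suc j) + measure_pmf.prob D {Suc j<..}"
      by (simp only:, subst measure_pmf.finite_measure_Union) (auto simp: measure_pmf_single)
    then show ?thesis by (simp add: u_def w_def algebra_simps)
  qed
  have a: "a t = u t + q * (\<Sum>j<t. u j * a (t - Suc j))" for t
    unfolding a_def u_def by (rule completion_tail_renewal[OF q])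
  show "a 0 = 1" using a[of 0] u0 by simp
  have "(\<Sum>j<t. u (Suc j) * a (t - Suc j)) =
      (1 - q) * (\<Sum>j<t. u j * a (t - Suc j)) - (\<Sum>j<t. w (Suc j) * a (t - Suc j))"
    by (simp add: u_Suc sum_distrib_left sum_subtractf[symmetric] algebra_simps)
  moreover have "(\<Sum>j<t. w (Suc j) * a (t - Suc j)) = (\<Sum>i\<le>t. w i * a (t - i))"
    by (simp add: sum.atMost_shift w0)
  moreover have "a (Suc t) = u (Suc t) + q * (a t + (\<Sum>j<t. u (Suc j) * a (t - Suc j)))"
    by (subst a) (simp add: sum.lessThan_Suc_shift u0 del: sum.lessThan_Suc)
  ultimately have "a (Suc t) = (1 - q) * u t - w (Suc t) +
      q * (a t + ((1 - q) * (\<Sum>j<t. u j * a (t - Suc j)) - (\<Sum>i\<le>t. w i * a (t - i))))"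
    by (simp add: u_Suc)
  \<comment> \<open>Regrouped so that the bracket is the renewal equation for
    \<open>a t\<close>.\<close>
  also have "\<dots> = (1 - q) * (u t + q * (\<Sum>j<t. u j * a (t - Suc j))) + q * a t - w (Suc t)
      - q * (\<Sum>i\<le>t. w i * a (t - i))"
    by (simp add: algebra_simps)
  also have "\<dots> = a t - w (Suc t) - q * (\<Sum>i\<le>t. w i * a (t - i))"
    by (simp only: a[symmetric]) (simp add: algebra_simps)
  finally show "a t - a (Suc t) = w (Suc t) + q * (\<Sum>i\<le>t. w i * a (t - i))" by simp
qed

lemma pgf_pos:
  assumes "0 < z" "z \<le> 1"
  shows "0 < pgf D z"
proof -
  obtain n where "n \<in> set_pmf D" using set_pmf_not_empty[of D] by blast
  then have "0 < pmf D n * z ^ n" using assms by (simp add: pmf_positive_iff)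
  also have "\<dots> \<le> (\<Sum>k. pmf D k * z ^ k)"
    using sum_le_suminf[of "\<lambda>k. pmf D k * z ^ k" "{n}"] pgf_sums[of z D] assms
    by (auto simp: sums_iff)
  also have "\<dots> = pgf D z" using pgf_sums[of z D] assms by (simp add: sums_iff)
  finally show ?thesis .
qed

lemma defective_renewal_completion_tail:
  assumes q: "0 < q" "q < 1" and D: "0 \<notin> set_pmf D"
  shows "defective_renewal q (pgf D (1 - q)) ((1 - q) * deriv (pgf D) (1 - q))
    (\<lambda>k. pmf D k * (1 - q) ^ k) (completion_tail q D)"
proof
  show "pmf D 0 * (1 - q) ^ 0 = 0" using D by (simp add: set_pmf_iff)
qed (use q completion_tail_rec[OF q D] in
    \<open>auto intro!: pgf_pos pgf_sums deriv_pgf_sums decseq_completion_tail simp: completion_tail_def\<close>)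

text \<open>The mean of a natural-number variable is the sum of its tails. Their summability keeps
  the nonnegative integral finite, so \<open>enn2real\<close> returns the true mean.\<close>

lemma expected_completion_time_eq:
  assumes q: "0 < q" "q < 1" and D: "0 \<notin> set_pmf D"
  shows "expected_completion_time q D = (1 - pgf D (1 - q)) / (q * pgf D (1 - q))"
proof -
  interpret prob_space "attempts q D" by (rule prob_space_attempts)
  interpret defective_renewal q "pgf D (1 - q)" "(1 - q) * deriv (pgf D) (1 - q)"
    "\<lambda>k. pmf D k * (1 - q) ^ k" "completion_tail q D"
    by (rule defective_renewal_completion_tail[OF assms])
  have "expected_completion_time q D = enn2real (\<integral>\<^sup>+\<omega>. of_nat (completion_time \<omega>) \<partial>attempts q D)"
    unfolding expected_completion_time_def
    by (subst integral_eq_nn_integral) (auto simp: ennreal_of_nat_eq_real_of_nat)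
  also have "(\<integral>\<^sup>+\<omega>. of_nat (completion_time \<omega>) \<partial>attempts q D) = (\<Sum>t. ennreal (completion_tail q D t))"
    by (subst nn_integral_nat_function) (simp_all add: completion_tail_def emeasure_eq_measure)
  also have "\<dots> = ennreal (\<Sum>t. completion_tail q D t)"
    by (intro suminf_ennreal2 a_nonneg summable_a)
  finally show ?thesis using suminf_nonneg[OF summable_a a_nonneg] by (simp add: suminf_a)
qed

section \<open>Distribution functions and bounds on the Kolmogorov distance\<close>

lemma cdf_normalized_completion_law:
  assumes E: "0 < expected_completion_time q D"
  shows "cdf (normalized_completion_law q D) y =
    (if y < 0 then 0 else 1 - completion_tail q D (nat \<lfloor>y * expected_completion_time q D\<rfloor>))"
proof -
  interpret prob_space "attempts q D" by (rule prob_space_attempts)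
  let ?E = "expected_completion_time q D"
  let ?A = "{\<omega> \<in> space (attempts q D). real (completion_time \<omega>) / ?E \<le> y}"
  have cdf: "cdf (normalized_completion_law q D) y = prob ?A"
    unfolding cdf_def normalized_completion_law_def
    by (subst measure_distr) (auto intro!: arg_cong[where f = prob])
  show ?thesis
  proof (cases "y < 0")
    case True
    then have "?A = {}" using E by (auto simp: not_le intro: less_le_trans[of y 0])
    then show ?thesis unfolding cdf using True by (simp only: measure_empty if_True)
  next
    case False
    \<comment> \<open>An integer is at most \<open>y * ?E\<close> exactly when it is at most the
      floor.\<close>
    have "real n / ?E \<le> y \<longleftrightarrow> \<not> nat \<lfloor>y * ?E\<rfloor> < n" for n
      using E False by (simp add: pos_divide_le_eq not_less le_nat_iff le_floor_iff)
    then have "?A = space (attempts q D) -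
        {\<omega> \<in> space (attempts q D). nat \<lfloor>y * ?E\<rfloor> < completion_time \<omega>}" by auto
    then have "prob ?A = 1 - completion_tail q D (nat \<lfloor>y * ?E\<rfloor>)"
      by (simp only:) (simp add: prob_compl completion_tail_def)
    then show ?thesis using cdf False by simp
  qed
qed

lemma cdf_exp1_law: "cdf exp1_law y = (if y < 0 then 0 else 1 - exp (- y))"
  unfolding cdf_def exp1_law_def measure_def
  by (subst emeasure_erlang_density) (auto simp: erlang_CDF_0)

text \<open>Distribution functions of probability measures differ by at most 1, so the real supremum
  is over a bounded set and dominates each value.\<close>

lemma kolmogorov_dist_upper:
  assumes "prob_space M" "prob_space N"
  shows "\<bar>cdf M y - cdf N y\<bar> \<le> kolmogorov_dist M N"
proof -
  have "\<bar>cdf M z - cdf N z\<bar> \<le> 1" for z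
    using assms[THEN prob_space.prob_le_1, of "{..z}"]
      measure_nonneg[of M "{..z}"] measure_nonneg[of N "{..z}"] unfolding cdf_def by linarith
  then show ?thesis
    unfolding kolmogorov_dist_def by (intro cSUP_upper bdd_aboveI2[of _ _ 1]) auto
qed

lemma kolmogorov_dist_least: "(\<And>y. \<bar>cdf M y - cdf N y\<bar> \<le> B) \<Longrightarrow> kolmogorov_dist M N \<le> B"
  unfolding kolmogorov_dist_def by (rule cSUP_least) auto

lemma kolmogorov_dist_completion_bounds:
  assumes q: "0 < q" "q < 1" and D: "0 \<notin> set_pmf D"
    and p: "pgf D (1 - q) \<le> 1 / 2"
    and K: "0 < K" "\<And>n. (real n)\<^sup>2 * (1 - q) ^ n \<le> K"
  defines "p \<equiv> pgf D (1 - q)" and "m \<equiv> (1 - q) * deriv (pgf D) (1 - q)"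
    and "d \<equiv> kolmogorov_dist (normalized_completion_law q D) exp1_law"
  shows "d \<le> 5 * p + 2 * q * m" and "q * p \<le> 4 * d" and "q * m \<le> 8 * d + (16 + K) * p"
proof -
  define a where "a = completion_tail q D"
  define x where "x = q * p / (1 - p)"
  interpret defective_renewal q p m "\<lambda>k. pmf D k * (1 - q) ^ k" a
    unfolding p_def m_def a_def by (rule defective_renewal_completion_tail[OF q D])
  have p_le: "p \<le> 1 / 2" using p by (simp add: p_def)
  have qp: "0 < q * p" "q * p \<le> p" using q p_pos by auto
  have x: "0 < x" "q * p \<le> x" "x \<le> 2 * (q * p)"
    using qp p_le mult_left_mono[of p "1/2" "q*p"] p_pos by (auto simp: x_def field_simps)
  have x1: "x \<le> 2 * p" "x \<le> 1" using x qp p_le by linarith+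
  have E: "expected_completion_time q D = 1 / x"
    using expected_completion_time_eq[OF q D] by (simp add: x_def p_def)
  have cdf: "cdf (normalized_completion_law q D) y = (if y < 0 then 0 else 1 - a (nat \<lfloor>y / x\<rfloor>))" for y
    using cdf_normalized_completion_law[of q D y] x by (simp add: E a_def)
  have "\<bar>cdf (normalized_completion_law q D) y - cdf exp1_law y\<bar> \<le> 5 * p + 2 * q * m" for y
  proof (cases "y < 0")
    case True
    then show ?thesis using p_pos m_nonneg q by (simp add: cdf cdf_exp1_law)
  next
    case False
    define n where "n = nat \<lfloor>y / x\<rfloor>"
    have "real n \<le> y / x" "y / x < real n + 1" using False x by (auto simp: n_def)
    then have n: "real n * x \<le> y" "y \<le> real n * x + x" using x by (auto simp: field_simps)
    \<comment> \<open>Rounding \<open>y\<close> down to the lattice of multiples of \<open>x\<close>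
      costs at most \<open>1 - exp (- x) \<le> x\<close>.\<close>
    have "exp (- (real n * x)) - exp (- y) \<le> 2 * p"
    proof -
      have "exp (- (real n * x)) - exp (- y) \<le> exp (- (real n * x)) * (1 - exp (- x))"
        using n by (simp add: right_diff_distrib mult_exp_exp)
      also have "\<dots> \<le> 1 * (1 - exp (- x))" using x by (intro mult_right_mono) auto
      also have "\<dots> \<le> x" using exp_ge_add_one_self[of "- x"] by simp
      finally show ?thesis using x1 by simp
    qed
    moreover have "exp (- y) \<le> exp (- (real n * x))" using n by simp
    moreover have "\<bar>a n - exp (- (real n * x))\<bar> \<le> 3 * p + 2 * q * m"
      unfolding x_def by (rule a_near_exp[OF q(2) p_le])
    ultimately have "\<bar>exp (- y) - a n\<bar> \<le> 5 * p + 2 * q * m" using p_pos by linarith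
    then show ?thesis using False by (simp add: cdf cdf_exp1_law n_def[symmetric])
  qed
  then show "d \<le> 5 * p + 2 * q * m" unfolding d_def by (rule kolmogorov_dist_least)
  have d: "\<bar>cdf (normalized_completion_law q D) y - cdf exp1_law y\<bar> \<le> d" for y
    unfolding d_def
  proof (rule kolmogorov_dist_upper)
    show "prob_space (normalized_completion_law q D)"
      unfolding normalized_completion_law_def
      by (intro prob_space.prob_space_distr prob_space_attempts) measurable
    show "prob_space exp1_law"
      unfolding exp1_law_def by (rule prob_space_exponential_density) simp
  qed
  \<comment> \<open>At \<open>y = x / 2\<close> the normalized time has no mass yet, since its floor
    index is 0 and \<open>a 0 = 1\<close>, while the exponential law already has mass
    \<open>1 - exp (- (x / 2))\<close>.\<close>
  have "x / 4 \<le> 1 - exp (- (x / 2))" using one_minus_exp_ge[of "x / 2"] x x1 by simp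
  also have "\<dots> \<le> d" using d[of "x / 2"] x by (simp add: cdf cdf_exp1_law a_0)
  finally show "q * p \<le> 4 * d" using x by simp
  show "q * m \<le> 8 * d + (16 + K) * p"
  proof (rule mean_le_of_near_exp[OF q(2) p_le])
    show "\<bar>a t - exp (- (real t * (q * p / (1 - p))))\<bar> \<le> d" for t
    proof -
      \<comment> \<open>At the lattice point \<open>y = t * x\<close> the two distribution functions
        are exactly \<open>1 - a t\<close> and \<open>1 - exp (- (t * x))\<close>.\<close>
      have "\<not> real t * x < 0" "real t * x / x = real t" using x by (simp_all add: not_less)
      then show ?thesis
        using d[of "real t * x"] by (simp add: cdf cdf_exp1_law x_def abs_minus_commute)
    qed
    have w_le: "(real k)\<^sup>2 * (pmf D k * (1 - q) ^ k) \<le> K * pmf D k" for k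
      using mult_left_mono[OF K(2)[of k], of "pmf D k"] by (simp add: ac_simps)
    have sD: "(\<lambda>k. pmf D k) sums 1" using pgf_sums[of 1 D] by (simp add: pgf_def)
    show summ: "summable (\<lambda>k. (real k)\<^sup>2 * (pmf D k * (1 - q) ^ k))"
      by (rule summable_comparison_test'[OF summable_mult[OF sums_summable[OF sD], of K]])
        (use w_le q in \<open>auto simp: abs_mult\<close>)
    show "(\<Sum>k. (real k)\<^sup>2 * (pmf D k * (1 - q) ^ k)) \<le> K"
      using sums_le[OF w_le summable_sums[OF summ] sums_mult[OF sD]] by simp
  qed
qed

theorem theorem1p4:
  fixes q :: real
  assumes "0 < q" and "q < 1"
  shows "\<exists>c_A C_A \<delta>_A :: real. 0 < c_A \<and> 0 < C_A \<and> 0 < \<delta>_A \<and>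
    (\<forall>D :: nat pmf. 0 \<notin> set_pmf D \<longrightarrow>
      (let s = 1 - q;
           p = pgf D s;
           \<alpha> = s * (p - q * deriv (pgf D) s) / (1 - p);
           d = kolmogorov_dist (normalized_completion_law q D) exp1_law
       in p + \<bar>\<alpha>\<bar> \<le> \<delta>_A \<longrightarrow>
          c_A * (p + \<bar>\<alpha>\<bar>) \<le> d \<and> d \<le> C_A * (p + \<bar>\<alpha>\<bar>)))"
proof -
  obtain K where K: "0 < K" "\<And>n. (real n)\<^sup>2 * (1 - q) ^ n \<le> K"
    using square_times_power_bounded[of "1 - q"] assms by auto
  \<comment> \<open>Chosen for the chain \<open>p + |\<alpha>| \<le> 3 * p + 2 * q * m \<le> 16 * d
    + (35 + 2 * K) * p\<close>, into which \<open>p \<le> 4 * d / q\<close> is inserted.\<close>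
  define C where "C = 16 + (140 + 8 * K) / q"
  have C: "0 < C" using K assms by (auto simp: C_def intro!: add_pos_pos divide_pos_pos)
  \<comment> \<open>The 7 comes from \<open>d \<le> 5 * p + 2 * q * m\<close> and
    \<open>q * m \<le> p + |\<alpha>|\<close>. The threshold 1/2 serves to give
    \<open>p \<le> 1 / 2\<close>.\<close>
  have main: "1 / C * (p + \<bar>\<alpha>\<bar>) \<le> d \<and> d \<le> 7 * (p + \<bar>\<alpha>\<bar>)"
    if D: "0 \<notin> set_pmf D" and p: "p = pgf D (1 - q)"
      and \<alpha>: "\<alpha> = (1 - q) * (p - q * deriv (pgf D) (1 - q)) / (1 - p)"
      and d: "d = kolmogorov_dist (normalized_completion_law q D) exp1_law"
      and small: "p + \<bar>\<alpha>\<bar> \<le> 1 / 2"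
    for D p \<alpha> d
  proof -
    define m where "m = (1 - q) * deriv (pgf D) (1 - q)"
    have p0: "0 < p" using pgf_pos[of "1 - q" D] assms p by simp
    have p_half: "p \<le> 1 / 2" using small by linarith
    then have "pgf D (1 - q) \<le> 1 / 2" using p by simp
    note bounds = kolmogorov_dist_completion_bounds[OF assms D this K, folded m_def p d]
    have \<alpha>_eq: "\<alpha> * (1 - p) = (1 - q) * p - q * m"
    proof -
      have "\<alpha> * (1 - p) = (1 - q) * (p - q * deriv (pgf D) (1 - q))" using p_half by (simp add: \<alpha>)
      then show ?thesis by (simp add: m_def algebra_simps)
    qed
    have sp: "0 \<le> (1 - q) * p" "(1 - q) * p \<le> p" using assms p0 by auto
    have "q * m \<le> (1 - q) * p + \<bar>\<alpha>\<bar> * (1 - p)"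
      using \<alpha>_eq mult_right_mono[OF abs_ge_minus_self[of \<alpha>], of "1 - p"] p_half by simp
    also have "\<bar>\<alpha>\<bar> * (1 - p) \<le> \<bar>\<alpha>\<bar> * 1" using p0 by (intro mult_left_mono) auto
    finally have qm: "q * m \<le> p + \<bar>\<alpha>\<bar>" using sp by linarith
    \<comment> \<open>The converse comparison: \<open>1 - p \<ge> 1 / 2\<close> turns the identity
      for \<open>\<alpha> * (1 - p)\<close> into
      \<open>|\<alpha>| \<le> 2 * (p + q * m)\<close>.\<close>
    have "\<bar>\<alpha>\<bar> * (1 / 2) \<le> \<bar>\<alpha>\<bar> * (1 - p)" using p_half by (intro mult_left_mono) auto
    also have "\<dots> = \<bar>\<alpha> * (1 - p)\<bar>" using p_half by (simp add: abs_mult)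
    also have "\<dots> \<le> p + \<bar>q * m\<bar>" using \<alpha>_eq sp by linarith
    also have "\<bar>q * m\<bar> = q * m"
      using defective_renewal.m_nonneg[OF defective_renewal_completion_tail[OF assms D]] assms
      by (simp add: m_def)
    finally have "p + \<bar>\<alpha>\<bar> \<le> 3 * p + 2 * (q * m)" by simp
    also have "\<dots> \<le> 16 * d + (35 + 2 * K) * p" using bounds(3) by (simp add: algebra_simps)
    also have "(35 + 2 * K) * p \<le> (35 + 2 * K) * (4 * d / q)"
      using bounds(2) K assms by (intro mult_left_mono) (auto simp: field_simps)
    also have "16 * d + \<dots> = C * d" using assms by (simp add: C_def field_simps)
    finally have "p + \<bar>\<alpha>\<bar> \<le> C * d" by simp
    then have "1 / C * (p + \<bar>\<alpha>\<bar>) \<le> d" using C by (simp add: field_simps)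
    moreover have "d \<le> 7 * (p + \<bar>\<alpha>\<bar>)" using bounds(1) qm by (simp add: algebra_simps)
    ultimately show ?thesis by blast
  qed
  have "\<forall>D :: nat pmf. 0 \<notin> set_pmf D \<longrightarrow>
      (let s = 1 - q;
           p = pgf D s;
           \<alpha> = s * (p - q * deriv (pgf D) s) / (1 - p);
           d = kolmogorov_dist (normalized_completion_law q D) exp1_law
       in p + \<bar>\<alpha>\<bar> \<le> 1 / 2 \<longrightarrow>
          1 / C * (p + \<bar>\<alpha>\<bar>) \<le> d \<and> d \<le> 7 * (p + \<bar>\<alpha>\<bar>))"
    unfolding Let_def using main[OF _ refl refl refl] by blast
  then show ?thesis using C
    by (intro exI[of _ "1 / C"] exI[of _ 7] exI[of _ "1 / 2"]) simp
qed

end
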